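(* Let $\mathcal{X}$ and $\mathcal{Y}$ be two Banach spaces and let $\mathcal{T}\subseteq\mathcal{X}$ and $\mathcal{S}\subseteq\mathcal{Y}$ be two closed subspaces. Then the set $$\mathcal{L}(\mathcal{X},\mathcal{Y})^{(2)}_{\mathcal{T},\mathcal{S}}=\{A\in\mathcal{L}(\mathcal{X},\mathcal{Y}): A^{(2)}_{\mathcal{T},\mathcal{S}}\text{ exists}\}$$ is open in $\mathcal{L}(\mathcal{X},\mathcal{Y})$.
   Context: $\mathcal{L}(\mathcal{X},\mathcal{Y})$ is the Banach space of bounded linear operators from $\mathcal{X}$ to $\mathcal{Y}$ with the operator norm. For $A\in\mathcal{L}(\mathcal{X},\mathcal{Y})$, the outer inverse $A^{(2)}_{\mathcal{T},\mathcal{S}}$ is the (necessarily unique, if it exists) operator $B\in\mathcal{L}(\mathcal{Y},\mathcal{X})$ with $BAB=B$, range $\mathcal{R}(B)=\mathcal{T}$ and null space $\mathcal{N}(B)=\mathcal{S}$. *)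

theory Defs
  imports "HOL-Analysis.Analysis"
begin

text \<open>
  The scalar field of a Banach space may be real or complex, whereas the class \<open>banach\<close> only
  provides real scalars. We therefore equip a type of class \<open>banach\<close> with a multiplication by
  scalars from a type \<open>'k\<close> of class \<open>real_normed_field\<close>, compatible with the norm and with the
  real scalar multiplication; \<open>'k = real\<close> with \<open>scaleR\<close> gives real Banach spaces, and
  \<open>'k = complex\<close> gives complex ones.
\<close>

locale banach_over = vector_space scale
  for scale :: "'k::real_normed_field \<Rightarrow> 'a::banach \<Rightarrow> 'a" +
  assumes norm_scale: "norm (scale c x) = norm c * norm x"
    and scale_of_real: "scale (of_real r) x = r *\<^sub>R x"

lemma banach_over_real: "banach_over (scaleR :: real \<Rightarrow> 'a::banach \<Rightarrow> 'a)"
  by unfold_locales (simp_all add: algebra_simps)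

lemma banach_over_complex: "banach_over ((*) :: complex \<Rightarrow> complex \<Rightarrow> complex)"
  by unfold_locales (simp_all add: algebra_simps norm_mult scaleR_conv_of_real)

text \<open>
  The \<open>'k\<close>-linear operators form a subset of the type of bounded real-linear operators, whose norm
  is the operator norm; for
  \<open>scaleR\<close> this subset is the whole type.
\<close>

definition bounded_operators ::
  "('k::real_normed_field \<Rightarrow> 'a::banach \<Rightarrow> 'a) \<Rightarrow> ('k \<Rightarrow> 'b::banach \<Rightarrow> 'b) \<Rightarrow> ('a \<Rightarrow>\<^sub>L 'b) set"
  where "bounded_operators sX sY = {A. Vector_Spaces.linear sX sY (blinfun_apply A)}"

lemma bounded_operators_scaleR: "bounded_operators scaleR scaleR = UNIV"
  by (auto simp: bounded_operators_def blinfun.add_right blinfun.scaleR_right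
      intro!: linearI simp flip: linear_def)

definition is_outer_inverse ::
  "('k::real_normed_field \<Rightarrow> 'a::banach \<Rightarrow> 'a) \<Rightarrow> ('k \<Rightarrow> 'b::banach \<Rightarrow> 'b) \<Rightarrow>
    'a set \<Rightarrow> 'b set \<Rightarrow> ('a \<Rightarrow>\<^sub>L 'b) \<Rightarrow> ('b \<Rightarrow>\<^sub>L 'a) \<Rightarrow> bool"
  where "is_outer_inverse sX sY T S A B \<longleftrightarrow>
    B \<in> bounded_operators sY sX \<and> B o\<^sub>L A o\<^sub>L B = B \<and>
    range (blinfun_apply B) = T \<and> {y. blinfun_apply B y = 0} = S"

lemma is_outer_inverse_unique:
  assumes B: "is_outer_inverse sX sY T S A B" and C: "is_outer_inverse sX sY T S A C"
  shows "B = C"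
proof (rule blinfun_eqI)
  fix y
  have BAB: "B (A (B z)) = B z" for z
    using B unfolding is_outer_inverse_def by (metis blinfun_apply_blinfun_compose)
  have CAC: "C (A (C z)) = C z" for z
    using C unfolding is_outer_inverse_def by (metis blinfun_apply_blinfun_compose)
  have "C (y - A (C y)) = 0"
    by (simp add: blinfun.diff_right CAC)
  then have "B (y - A (C y)) = 0"
    using B C unfolding is_outer_inverse_def by blast
  moreover obtain z where "C y = B z"
    using B C unfolding is_outer_inverse_def by (metis rangeE rangeI)
  ultimately show "B y = C y"
    by (simp add: blinfun.diff_right BAB)
qed

definition operators_with_outer_inverse ::
  "('k::real_normed_field \<Rightarrow> 'a::banach \<Rightarrow> 'a) \<Rightarrow> ('k \<Rightarrow> 'b::banach \<Rightarrow> 'b) \<Rightarrow>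
    'a set \<Rightarrow> 'b set \<Rightarrow> ('a \<Rightarrow>\<^sub>L 'b) set"
  where "operators_with_outer_inverse sX sY T S =
    {A \<in> bounded_operators sX sY. \<exists>B. is_outer_inverse sX sY T S A B}"

end

theory Submission
  imports Defs
begin

text \<open>
  If \<open>B\<close> is the outer inverse of \<open>A\<close> and \<open>\<parallel>B\<parallel> \<parallel>A' - A\<parallel> < 1\<close>, then \<open>I + B (A' - A)\<close> is invertible
  and \<open>(I + B (A' - A))\<inverse> B\<close> is the outer inverse of \<open>A'\<close> with the same range and null space.
\<close>

text \<open>The map \<open>x + K x\<close> is bounded below by \<open>1 - norm K > 0\<close>, which
  gives injectivity and bounds the inverse. It is onto because a solution of
  \<open>x + K x = y\<close> is a fixed point of the contraction sending \<open>x\<close> to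
  \<open>y - K x\<close>.\<close>

lemma one_plus_blinfun_inverse:
  fixes K :: "'a::banach \<Rightarrow>\<^sub>L 'a"
  assumes K: "norm K < 1"
  obtains U :: "'a \<Rightarrow>\<^sub>L 'a"
  where "\<And>x. U (x + K x) = x" and "\<And>y. U y + K (U y) = y"
proof -
  have lower: "(1 - norm K) * norm x \<le> norm (x + K x)" for x
    using norm_blinfun[of K x] norm_triangle_ineq2[of x "- K x"]
    by (simp add: algebra_simps)
  have inj: "x = x'" if "x + K x = x' + K x'" for x x'
  proof -
    have "(1 - norm K) * norm (x - x') \<le> 0"
      using lower[of "x - x'"] that by (simp add: blinfun.diff_right algebra_simps)
    then show ?thesis
      using K by (simp add: mult_le_0_iff)
  qed
  have surj: "\<exists>x. x + K x = y" for y
  proof -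
    have "dist (y - K x) (y - K x') \<le> norm K * dist x x'" for x x'
      using norm_blinfun[of K "x - x'"]
      by (simp add: dist_norm blinfun.diff_right norm_minus_commute)
    then obtain x where "y - K x = x"
      using banach_fix_type[of "norm K" "\<lambda>x. y - K x"] K by auto
    then show ?thesis
      by (metis diff_add_cancel)
  qed
  define u where "u y = (SOME x. x + K x = y)" for y
  have u: "u y + K (u y) = y" for y
    unfolding u_def by (rule someI_ex[OF surj])
  \<comment> \<open>For linearity, injectivity reduces each identity for \<open>u\<close> to its
    image under \<open>x + K x\<close>, where \<open>u\<close> cancels.\<close>
  have "bounded_linear u"
  proof
    show "u (x + y) = u x + u y" for x y
    proof (rule inj)
      have "u x + u y + K (u x + u y) = (u x + K (u x)) + (u y + K (u y))"
        by (simp only: blinfun.add_right add_ac)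
      then show "u (x + y) + K (u (x + y)) = u x + u y + K (u x + u y)"
        by (simp only: u)
    qed
    show "u (r *\<^sub>R x) = r *\<^sub>R u x" for r x
      by (rule inj) (simp only: u blinfun.scaleR_right flip: scaleR_right_distrib)
    have "norm (u x) \<le> norm x * (1 / (1 - norm K))" for x
      using lower[of "u x"] K by (simp only: u) (simp add: pos_le_divide_eq mult.commute)
    then show "\<exists>C. \<forall>x. norm (u x) \<le> norm x * C"
      by blast
  qed
  then have "blinfun_apply (Blinfun u) = u"
    by (rule bounded_linear_Blinfun_apply)
  moreover have "u (x + K x) = x" for x
    by (rule inj) (rule u)
  ultimately show thesis
    using that[of "Blinfun u"] u by simp
qed

lemma is_outer_inverse_perturb:
  fixes sX :: "'k::real_normed_field \<Rightarrow> 'a::banach \<Rightarrow> 'a"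
    and sY :: "'k \<Rightarrow> 'b::banach \<Rightarrow> 'b"
  assumes A: "A \<in> bounded_operators sX sY" and A': "A' \<in> bounded_operators sX sY"
    and B: "is_outer_inverse sX sY T S A B"
    and small: "norm B * norm (A' - A) < 1"
  shows "\<exists>B'. is_outer_inverse sX sY T S A' B'"
proof -
  define E where "E = A' - A"
  have "norm (B o\<^sub>L E) < 1"
    using norm_blinfun_compose[of B E] small by (simp add: E_def)
  then obtain U :: "'a \<Rightarrow>\<^sub>L 'a"
    where U: "\<And>x. U (x + B (E x)) = x" "\<And>y. U y + B (E (U y)) = y"
    by (rule one_plus_blinfun_inverse) auto
  have BAB: "B (A (B y)) = B y" for y
    using B unfolding is_outer_inverse_def by (metis blinfun_apply_blinfun_compose)
  have lA: "Vector_Spaces.linear sX sY A" and lA': "Vector_Spaces.linear sX sY A'"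
    and lB: "Vector_Spaces.linear sY sX B"
    using A A' B by (auto simp: is_outer_inverse_def bounded_operators_def)
  interpret A: Vector_Spaces.linear sX sY A by (rule lA)
  interpret A': Vector_Spaces.linear sX sY A' by (rule lA')
  interpret B: Vector_Spaces.linear sY sX B by (rule lB)
  have sE: "E (sX c x) = sY c (E x)" for c x
    by (simp add: E_def blinfun.diff_left A.scale A'.scale A.vs2.scale_right_diff_distrib)
  \<comment> \<open>\<open>U\<close> is so far only real-linear. It commutes with
    \<open>sX c\<close> because it inverts \<open>x + B (E x)\<close>, which does.\<close>
  have sU: "U (sX c x) = sX c (U x)" for c x
    by (metis U sE B.scale A.vs1.scale_right_distrib)
  \<comment> \<open>Solving the second equation of \<open>U\<close> for \<open>U (B y)\<close>
    exhibits it as a value of \<open>B\<close>. This yields one range inclusion and lets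
    \<open>B A\<close> act as the identity on \<open>U (B y)\<close>.\<close>
  have UB: "U (B y) = B (y - E (U (B y)))" for y
    using U(2)[of "B y"] by (simp add: blinfun.diff_right algebra_simps)
  have "is_outer_inverse sX sY T S A' (U o\<^sub>L B)"
    unfolding is_outer_inverse_def
  proof (intro conjI)
    show "U o\<^sub>L B \<in> bounded_operators sY sX"
      unfolding bounded_operators_def mem_Collect_eq
      by unfold_locales (simp_all add: blinfun.add_right B.scale sU)
    show "(U o\<^sub>L B) o\<^sub>L A' o\<^sub>L (U o\<^sub>L B) = U o\<^sub>L B"
    proof (rule blinfun_eqI)
      fix y
      define x where "x = U (B y)"
      \<comment> \<open>On the range of \<open>B\<close> the map \<open>B A\<close> is the identity,
        so \<open>B A'\<close> agrees there with \<open>I + B E\<close>, which \<open>U\<close>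
        undoes.\<close>
      have "B (A x) = x"
        unfolding x_def by (metis BAB UB)
      then have "B (A' x) = x + B (E x)"
        by (simp add: E_def blinfun.diff_left blinfun.diff_right)
      then show "blinfun_apply ((U o\<^sub>L B) o\<^sub>L A' o\<^sub>L (U o\<^sub>L B)) y = blinfun_apply (U o\<^sub>L B) y"
        using U(1)[of x] by (simp add: x_def)
    qed
    \<comment> \<open>The other range inclusion: \<open>I + B E\<close> sends \<open>B z\<close> to
      \<open>B (z + E (B z))\<close>, again in the range of \<open>B\<close>, and \<open>U\<close>
      brings it back.\<close>
    have "U (B (z + E (B z))) = B z" for z
      by (simp add: blinfun.add_right[of B] U)
    then have "range (\<lambda>y. U (B y)) = range B"
      using UB by (intro equalityI subsetI; elim rangeE) (metis rangeI)+
    then show "range (blinfun_apply (U o\<^sub>L B)) = T"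
      using B by (simp add: is_outer_inverse_def)
    \<comment> \<open>The null space is unchanged because \<open>U\<close> is injective.\<close>
    have "U (B y) = 0 \<longleftrightarrow> B y = 0" for y
      using U(2)[of "B y"] by auto
    then show "{y. blinfun_apply (U o\<^sub>L B) y = 0} = S"
      using B by (simp add: is_outer_inverse_def)
  qed
  then show ?thesis ..
qed

theorem theorem4p3:
  fixes sX :: "'k::real_normed_field \<Rightarrow> 'a::banach \<Rightarrow> 'a"
    and sY :: "'k \<Rightarrow> 'b::banach \<Rightarrow> 'b"
    and T :: "'a set" and S :: "'b set"
  assumes "banach_over sX" and "banach_over sY"
    and "module.subspace sX T" and "closed T"
    and "module.subspace sY S" and "closed S"
  shows "openin (top_of_set (bounded_operators sX sY)) (operators_with_outer_inverse sX sY T S)"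
  unfolding openin_euclidean_subtopology_iff
proof (intro conjI ballI)
  show "operators_with_outer_inverse sX sY T S \<subseteq> bounded_operators sX sY"
    by (auto simp: operators_with_outer_inverse_def)
  fix A assume "A \<in> operators_with_outer_inverse sX sY T S"
  then obtain B where A: "A \<in> bounded_operators sX sY" and B: "is_outer_inverse sX sY T S A B"
    by (auto simp: operators_with_outer_inverse_def)
  \<comment> \<open>The radius makes \<open>norm B * norm (A' - A) < 1\<close>; the added 1 keeps
    its denominator positive even when \<open>B = 0\<close>.\<close>
  have "A' \<in> operators_with_outer_inverse sX sY T S"
    if A': "A' \<in> bounded_operators sX sY" and dist: "dist A' A < 1 / (norm B + 1)" for A'
  proof -
    have "norm B * norm (A' - A) \<le> (norm B + 1) * dist A' A"
      by (simp add: dist_norm algebra_simps)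
    also have "\<dots> < 1"
      using dist pos_less_divide_eq[of "norm B + 1" "dist A' A" 1]
      by (simp add: add_nonneg_pos mult.commute)
    finally show ?thesis
      using is_outer_inverse_perturb[OF A A' B] A' by (simp add: operators_with_outer_inverse_def)
  qed
  moreover have "1 / (norm B + 1) > 0"
    by (simp add: add_nonneg_pos)
  ultimately show "\<exists>e>0. \<forall>A'\<in>bounded_operators sX sY. dist A' A < e \<longrightarrow>
      A' \<in> operators_with_outer_inverse sX sY T S"
    by blast
qed

end
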